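(* Suppose that $m \geq 2$ is an integer and $n \in \{m,m+1\}$. Then $r(B(m,n))=2m+n+2$.
   Context: All graphs are finite, simple and undirected. For a graph $G$, the Ramsey number $r(G)$ is the minimum $r$ such that any $2$-coloring of the edges of the complete graph $K_r$ yields a monochromatic subgraph (not necessarily induced) isomorphic to $G$. The bistar $B(m,n)$ is the tree with exactly two non-leaf vertices (called centers), which are adjacent to each other, one of them having exactly $m$ leaf neighbors (so degree $m+1$) and the other having exactly $n$ leaf neighbors (so degree $n+1$). *)

theory Defs
  imports Main "HOL-Library.Ramsey"
begin

type_synonym 'a graph = "'a set \<times> 'a set set"

abbreviation verts :: "'a graph \<Rightarrow> 'a set" where
  "verts G \<equiv> fst G"

abbreviation edges :: "'a graph \<Rightarrow> 'a set set" where
  "edges G \<equiv> snd G"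

text \<open>Edges are two-element sets of vertices (\<^term>\<open>nsets A 2\<close>), so loops, parallel edges and
  orientations are excluded.\<close>

definition simple_graph :: "'a graph \<Rightarrow> bool" where
  "simple_graph G \<longleftrightarrow> finite (verts G) \<and> edges G \<subseteq> nsets (verts G) 2"

definition complete_graph :: "nat \<Rightarrow> nat graph" where
  "complete_graph r = ({..<r}, nsets {..<r} 2)"

definition subgraph :: "'a graph \<Rightarrow> 'a graph \<Rightarrow> bool" where
  "subgraph H G \<longleftrightarrow> simple_graph H \<and> verts H \<subseteq> verts G \<and> edges H \<subseteq> edges G"

definition isomorphic :: "'a graph \<Rightarrow> 'b graph \<Rightarrow> bool" where
  "isomorphic G H \<longleftrightarrow> (\<exists>f. bij_betw f (verts G) (verts H) \<and>
     (\<forall>u\<in>verts G. \<forall>v\<in>verts G. {u, v} \<in> edges G \<longleftrightarrow> {f u, f v} \<in> edges H))"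

text \<open>The two colors are the values of type \<^typ>\<open>bool\<close>; only the values of a coloring on the edges of
  the complete graph matter.\<close>

definition ramsey_property :: "'a graph \<Rightarrow> nat \<Rightarrow> bool" where
  "ramsey_property G r \<longleftrightarrow> (\<forall>c :: nat set \<Rightarrow> bool. \<exists>H.
     subgraph H (complete_graph r) \<and> (\<exists>color. \<forall>e\<in>edges H. c e = color) \<and> isomorphic H G)"

definition ramsey_number :: "'a graph \<Rightarrow> nat" where
  "ramsey_number G = (LEAST r. ramsey_property G r)"

definition neighbors :: "'a graph \<Rightarrow> 'a \<Rightarrow> 'a set" where
  "neighbors G v = {w \<in> verts G. {v, w} \<in> edges G}"

definition leaves :: "'a graph \<Rightarrow> 'a set" where
  "leaves G = {v \<in> verts G. card (neighbors G v) = 1}"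

definition connected_graph :: "'a graph \<Rightarrow> bool" where
  "connected_graph G \<longleftrightarrow> verts G \<noteq> {} \<and>
     (\<forall>u\<in>verts G. \<forall>v\<in>verts G. (u, v) \<in> {(x, y). {x, y} \<in> edges G}\<^sup>*)"

definition is_cycle :: "'a graph \<Rightarrow> 'a list \<Rightarrow> bool" where
  "is_cycle G p \<longleftrightarrow> length p \<ge> 3 \<and> distinct p \<and> set p \<subseteq> verts G \<and>
     (\<forall>i<length p. {p ! i, p ! (Suc i mod length p)} \<in> edges G)"

definition tree :: "'a graph \<Rightarrow> bool" where
  "tree G \<longleftrightarrow> simple_graph G \<and> connected_graph G \<and> (\<nexists>p. is_cycle G p)"

text \<open>\<^term>\<open>bistar m n G\<close> means that \<open>G\<close> is a bistar \<open>B(m,n)\<close>, on an arbitrary vertex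
  set: \<open>B(m,n)\<close> is specified only up to isomorphism.\<close>

definition bistar :: "nat \<Rightarrow> nat \<Rightarrow> 'a graph \<Rightarrow> bool" where
  "bistar m n G \<longleftrightarrow> tree G \<and>
     (\<exists>u v. u \<noteq> v \<and> verts G - leaves G = {u, v} \<and> {u, v} \<in> edges G \<and>
        card (neighbors G u \<inter> leaves G) = m \<and> card (neighbors G v \<inter> leaves G) = n)"

lemma bistar_exists:
  assumes "m \<ge> 1" "n \<ge> 1"
  shows "\<exists>G :: nat graph. bistar m n G"
proof -
  define E where "E = {{0, 1}} \<union> (\<lambda>w. {0, w}) ` {2..<m + 2} \<union> (\<lambda>w. {1, w}) ` {m + 2..<m + n + 2}"
  define G where "G = ({..<m + n + 2}, E)"
  have E_iff: "{x, y} \<in> E \<longleftrightarrow>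
      (x = 0 \<and> (y = 1 \<or> y \<in> {2..<m + 2})) \<or> (y = 0 \<and> (x = 1 \<or> x \<in> {2..<m + 2})) \<or>
      (x = 1 \<and> y \<in> {m + 2..<m + n + 2}) \<or> (y = 1 \<and> x \<in> {m + 2..<m + n + 2})" for x y
    unfolding E_def by (auto simp: doubleton_eq_iff image_iff)
  have nb: "neighbors G x = {w. w < m + n + 2 \<and> {x, w} \<in> E}" for x
    by (auto simp: neighbors_def G_def)
  have nb0: "neighbors G 0 = {1..<m + 2}"
    unfolding nb E_iff by auto
  have nb1: "neighbors G 1 = insert 0 {m + 2..<m + n + 2}"
    unfolding nb E_iff by auto
  have nb2: "neighbors G x = {if x < m + 2 then 0 else 1}" if "2 \<le> x" "x < m + n + 2" for x
    using that unfolding nb E_iff by auto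
  have leaves: "leaves G = {2..<m + n + 2}"
  proof (rule set_eqI)
    fix x :: nat
    consider "x = 0" | "x = 1" | "2 \<le> x" by linarith
    then show "x \<in> leaves G \<longleftrightarrow> x \<in> {2..<m + n + 2}"
      using assms nb0 nb1 nb2 by cases (auto simp: leaves_def G_def)
  qed
  have simple: "simple_graph G"
    unfolding simple_graph_def G_def E_def by (auto simp: nsets_def)
  let ?R = "{(x, y). {x, y} \<in> edges G}"
  have symR: "sym (?R\<^sup>*)"
    by (intro sym_rtrancl) (auto simp: sym_def insert_commute)
  have to0: "(x, 0) \<in> ?R\<^sup>*" if "x < m + n + 2" for x
  proof -
    have "(1, 0) \<in> ?R" by (simp add: G_def E_iff)
    moreover have "(x, 0) \<in> ?R \<or> (x, 1) \<in> ?R \<or> x = 0"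
      using that by (auto simp: G_def E_iff)
    ultimately show ?thesis
      by (meson r_into_rtrancl rtrancl.rtrancl_into_rtrancl rtrancl.rtrancl_refl)
  qed
  have "(u, v) \<in> ?R\<^sup>*" if "u \<in> verts G" "v \<in> verts G" for u v
  proof -
    have "(u, 0) \<in> ?R\<^sup>*" "(0, v) \<in> ?R\<^sup>*"
      using that to0 symD[OF symR] by (auto simp: G_def)
    then show ?thesis by (rule rtrancl_trans)
  qed
  then have conn: "connected_graph G"
    unfolding connected_graph_def by (auto simp: G_def)
  have acyclic: False if "is_cycle G p" for p
  proof -
    let ?l = "length p"
    have l: "?l \<ge> 3" and dist: "distinct p" and sub: "set p \<subseteq> verts G"
      and edge: "\<And>i. i < ?l \<Longrightarrow> {p ! i, p ! (Suc i mod ?l)} \<in> edges G"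
      using that unfolding is_cycle_def by auto
    have in01: "p ! i \<in> {0, 1}" if i: "i < ?l" for i
    proof (rule ccontr)
      assume not01: "p ! i \<notin> {0, 1}"
      have "p ! i \<in> verts G" using i sub by auto
      then have "2 \<le> p ! i" "p ! i < m + n + 2" using not01 by (auto simp: G_def)
      then obtain w where w: "neighbors G (p ! i) = {w}" using nb2 by blast
      define j where "j = (if i = 0 then ?l - 1 else i - 1)"
      define k where "k = Suc i mod ?l"
      have j: "j < ?l" "Suc j mod ?l = i" using i l by (auto simp: j_def)
      have k: "k < ?l" unfolding k_def using l by (intro mod_less_divisor) linarith
      have "j \<noteq> k"
        using i l by (cases "Suc i = ?l") (auto simp: j_def k_def)
      have "p ! k \<in> neighbors G (p ! i)"
        using edge[OF i] sub k unfolding neighbors_def k_def by auto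
      moreover have "p ! j \<in> neighbors G (p ! i)"
        using edge[OF j(1)] sub j unfolding neighbors_def by (auto simp: insert_commute)
      ultimately show False
        using w \<open>j \<noteq> k\<close> j k dist by (auto simp: nth_eq_iff_index_eq)
    qed
    have "set p \<subseteq> {0, 1}"
    proof
      fix x assume "x \<in> set p"
      then obtain i where "i < ?l" "p ! i = x" by (auto simp: in_set_conv_nth)
      then show "x \<in> {0, 1}" using in01[of i] by simp
    qed
    then have "card (set p) \<le> card {0, 1 :: nat}" by (intro card_mono) auto
    then have "?l \<le> 2" unfolding distinct_card[OF dist] by simp
    then show False using l by linarith
  qed
  have "neighbors G 0 \<inter> leaves G = {2..<m + 2}" "neighbors G 1 \<inter> leaves G = {m + 2..<m + n + 2}"
    unfolding nb0 nb1 leaves by auto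
  moreover have "verts G - leaves G = {0, 1}"
    unfolding leaves by (auto simp: G_def)
  moreover have "{0, 1} \<in> edges G" by (simp add: G_def E_iff)
  ultimately have "\<exists>u v. u \<noteq> v \<and> verts G - leaves G = {u, v} \<and> {u, v} \<in> edges G \<and>
      card (neighbors G u \<inter> leaves G) = m \<and> card (neighbors G v \<inter> leaves G) = n"
    by (intro exI[of _ 0] exI[of _ 1]) simp
  then have "bistar m n G"
    unfolding bistar_def tree_def using simple conn acyclic
    by blast
  then show ?thesis by blast
qed

end

theory Submission
  imports Defs
begin

text \<open>
  Every bistar consists of a central edge \<open>uv\<close>, a set \<open>A\<close> of \<open>m\<close> leaves at \<open>u\<close> and a disjoint set
  \<open>B\<close> of \<open>n\<close> leaves at \<open>v\<close>, so the Ramsey property of \<open>B(m,n)\<close> only asks for such quadruples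
  \<open>u\<close>, \<open>v\<close>, \<open>A\<close>, \<open>B\<close> inside one color class (\<open>ramsey_property_bistar_iff\<close>).

  Lower bound. Color an edge on at most \<open>2m + n + 1\<close> vertices by whether it stays within a fixed set
  of \<open>m + n + 1\<close> vertices or within the complement, which has at most \<open>m\<close> vertices. A bistar inside
  one of the two parts has too many vertices, and a bistar all of whose edges cross places its
  bipartition classes, of sizes \<open>m + 1\<close> and \<open>n + 1\<close>, in different parts, one of which is too small.

  Upper bound. Let \<open>N = 2m + n + 2\<close> vertices be given. An edge \<open>uv\<close> of a color carries a bistar as
  soon as the degrees of \<open>u\<close> and \<open>v\<close> in this color are at least \<open>m + 1\<close> and \<open>n + 1\<close> and their
  neighborhoods together cover \<open>m + n + 2\<close> vertices (\<open>monochromatic_bistarI\<close>). Suppose that there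
  is no monochromatic bistar. Then no degree in a color exceeds \<open>m + n\<close>
  (\<open>color_degree_le\<close>), so that, the two degrees at a vertex adding up to \<open>N - 1\<close>, every degree in a
  color is at least \<open>m + 1\<close>. Since \<open>n \<le> m + 1\<close>, the neighborhoods of the ends of an edge, in its
  color, cover at most \<open>m + n + 1\<close> vertices: either one end has degree at least \<open>n + 1\<close>, and this is
  the absence of a bistar, or both degrees are at most \<open>n\<close> and \<open>2n \<le> m + n + 1\<close>. So at least \<open>m + 1\<close>
  vertices are joined to both ends by the other color.

  Now fix one vertex \<open>w\<close> with red degree \<open>r\<close> and blue degree \<open>b\<close>, and classify the \<open>rb\<close> pairs of a red
  and a blue neighbor of \<open>w\<close> by the color of the edge that joins them. A pair joined in
  red amounts to a blue edge at \<open>w\<close> together with a vertex joined in red to both of its ends, and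
  similarly with the colors exchanged. Therefore
  \<open>rb \<ge> (r + b)(m + 1)\<close>, and as \<open>4rb \<le> (r + b)\<^sup>2\<close> this gives \<open>4(m + 1) \<le> r + b = 2m + n + 1\<close>, which
  is false for \<open>n \<le> m + 1\<close>.
\<close>

section \<open>Bistars as double stars\<close>

definition double_star :: "'a \<Rightarrow> 'a \<Rightarrow> 'a set \<Rightarrow> 'a set \<Rightarrow> 'a graph" where
  "double_star u v A B =
     ({u, v} \<union> A \<union> B, {{u, v}} \<union> (\<lambda>x. {u, x}) ` A \<union> (\<lambda>x. {v, x}) ` B)"

definition double_star_data :: "nat \<Rightarrow> nat \<Rightarrow> 'a \<Rightarrow> 'a \<Rightarrow> 'a set \<Rightarrow> 'a set \<Rightarrow> bool" where
  "double_star_data m n u v A B \<longleftrightarrow> u \<noteq> v \<and> u \<notin> A \<union> B \<and> v \<notin> A \<union> B \<and> A \<inter> B = {} \<and>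
     finite A \<and> finite B \<and> card A = m \<and> card B = n"

lemma edge_double_star_iff:
  "{x, y} \<in> edges (double_star u v A B) \<longleftrightarrow>
     x = u \<and> y = v \<or> x = v \<and> y = u \<or> x = u \<and> y \<in> A \<or> y = u \<and> x \<in> A \<or>
     x = v \<and> y \<in> B \<or> y = v \<and> x \<in> B"
  unfolding double_star_def by (auto simp: doubleton_eq_iff image_iff)

lemma simple_graph_edgeD:
  assumes "simple_graph G" "e \<in> edges G"
  shows "\<exists>x y. x \<in> verts G \<and> y \<in> verts G \<and> x \<noteq> y \<and> e = {x, y}"
proof -
  have e: "e \<subseteq> verts G" "card e = 2" using assms by (auto simp: simple_graph_def nsets_def)
  obtain x y where "e = {x, y}" "x \<noteq> y" using e(2) card_2_iff by metis
  then show ?thesis using e(1) by blast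
qed

lemma simple_graph_double_star:
  assumes "double_star_data m n u v A B"
  shows "simple_graph (double_star u v A B)"
  using assms unfolding simple_graph_def double_star_def double_star_data_def
  by (auto simp: nsets_def card_insert_if)

lemma leaf_neighbor_unique:
  assumes "x \<in> leaves G" "y \<in> neighbors G x" "z \<in> neighbors G x"
  shows "y = z"
  using assms unfolding leaves_def by (auto simp: card_1_singleton_iff)

text \<open>Two adjacent leaves form a connected component, which is the whole graph; so a leaf is adjacent
  to a leaf only in the one-edge graph, which has no other vertex.\<close>

lemma neighbor_of_leaf_not_leaf:
  assumes simple: "simple_graph G" and conn: "connected_graph G" and u: "u \<in> verts G" "u \<notin> leaves G"
    and x: "x \<in> leaves G" and y: "y \<in> neighbors G x"
  shows "y \<notin> leaves G"
proof
  assume yl: "y \<in> leaves G"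
  have xv: "x \<in> verts G" using x by (simp add: leaves_def)
  have yx: "x \<in> neighbors G y"
    using y xv unfolding neighbors_def by (auto simp: insert_commute)
  have closed: "b \<in> {x, y}" if "a \<in> {x, y}" "{a, b} \<in> edges G" for a b
  proof -
    have "b \<in> verts G" using simple that(2) by (auto simp: simple_graph_def nsets_def)
    then have "b \<in> neighbors G a" using that by (simp add: neighbors_def)
    then show ?thesis
      using that(1) leaf_neighbor_unique[OF x y] leaf_neighbor_unique[OF yl yx] by blast
  qed
  have "(x, u) \<in> {(a, b). {a, b} \<in> edges G}\<^sup>*"
    using conn xv u unfolding connected_graph_def by blast
  moreover have "z \<in> {x, y}" if "(x, z) \<in> {(a, b). {a, b} \<in> edges G}\<^sup>*" for z
    using that
  proof (induction rule: rtrancl_induct)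
    case base
    show ?case by simp
  next
    case (step a b)
    then show ?case using closed by blast
  qed
  ultimately show False using u x yl by blast
qed

text \<open>A leaf can only be joined to one of the two non-leaves, so every edge other than the central one
  is counted by one of the two sets of leaf neighbors.\<close>

lemma bistar_is_double_star:
  assumes "bistar m n G" "m \<ge> 1" "n \<ge> 1"
  shows "\<exists>u v A B. double_star_data m n u v A B \<and> G = double_star u v A B"
proof -
  obtain u v where tree: "tree G" and uv: "u \<noteq> v" "verts G - leaves G = {u, v}" "{u, v} \<in> edges G"
    and cA: "card (neighbors G u \<inter> leaves G) = m" and cB: "card (neighbors G v \<inter> leaves G) = n"
    using assms(1) unfolding bistar_def by blast
  have simple: "simple_graph G" and conn: "connected_graph G"
    using tree by (auto simp: tree_def)
  define A where "A = neighbors G u \<inter> leaves G"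
  define B where "B = neighbors G v \<inter> leaves G"
  have leaf_nb: "y = u \<or> y = v" if "x \<in> leaves G" "y \<in> neighbors G x" for x y
    using neighbor_of_leaf_not_leaf[OF simple conn _ _ that, of u] uv that(2) by (auto simp: neighbors_def)
  have sym: "a \<in> neighbors G b" if "b \<in> neighbors G a" "a \<in> verts G" for a b
    using that by (auto simp: neighbors_def insert_commute)
  have leafset: "leaves G = A \<union> B"
  proof
    show "leaves G \<subseteq> A \<union> B"
    proof
      fix x assume x: "x \<in> leaves G"
      then obtain y where "y \<in> neighbors G x"
        unfolding leaves_def by (auto simp: card_1_singleton_iff)
      then show "x \<in> A \<union> B"
        using leaf_nb[OF x] sym x unfolding A_def B_def leaves_def by blast
    qed
  qed (auto simp: A_def B_def)
  have sub: "leaves G \<subseteq> verts G" by (auto simp: leaves_def)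
  have verts: "verts G = {u, v} \<union> A \<union> B" using uv(2) leafset sub by blast
  have fin: "finite A" "finite B"
    using simple sub leafset unfolding simple_graph_def by (auto intro: finite_subset)
  have "A \<inter> B = {}"
  proof (rule ccontr)
    assume "A \<inter> B \<noteq> {}"
    then obtain x where x: "x \<in> leaves G" "x \<in> neighbors G u" "x \<in> neighbors G v"
      unfolding A_def B_def by blast
    then have "u \<in> neighbors G x" "v \<in> neighbors G x" using sym verts by auto
    then show False using leaf_neighbor_unique[OF x(1)] uv(1) by blast
  qed
  then have data: "double_star_data m n u v A B"
    using fin uv cA cB unfolding double_star_data_def A_def B_def by blast
  have edge_iff: "{x, y} \<in> edges G \<longleftrightarrow> {x, y} \<in> edges (double_star u v A B)"
    if x: "x \<in> verts G" and y: "y \<in> verts G" and xy: "x \<noteq> y" for x y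
  proof
    assume "{x, y} \<in> edges G"
    then have nb: "y \<in> neighbors G x" "x \<in> neighbors G y"
      using x y by (auto simp: neighbors_def insert_commute)
    consider "x \<in> leaves G" | "y \<in> leaves G" | "x \<in> {u, v}" "y \<in> {u, v}"
      using x y uv(2) by blast
    then show "{x, y} \<in> edges (double_star u v A B)"
    proof cases
      case 1
      then show ?thesis
        using leaf_nb[OF 1 nb(1)] nb unfolding edge_double_star_iff A_def B_def by blast
    next
      case 2
      then show ?thesis
        using leaf_nb[OF 2 nb(2)] nb unfolding edge_double_star_iff A_def B_def by blast
    next
      case 3
      then show ?thesis using xy unfolding edge_double_star_iff by blast
    qed
  next
    assume "{x, y} \<in> edges (double_star u v A B)"
    then show "{x, y} \<in> edges G"
      using uv(3) unfolding edge_double_star_iff A_def B_def neighbors_def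
      by (auto simp: insert_commute)
  qed
  have verts': "verts (double_star u v A B) = verts G" by (simp add: double_star_def verts)
  have "e \<in> edges G \<longleftrightarrow> e \<in> edges (double_star u v A B)" for e
  proof -
    have "\<exists>x y. x \<in> verts G \<and> y \<in> verts G \<and> x \<noteq> y \<and> e = {x, y}"
      if "e \<in> edges G \<or> e \<in> edges (double_star u v A B)"
      using that simple_graph_edgeD[OF simple]
        simple_graph_edgeD[OF simple_graph_double_star[OF data], unfolded verts'] by blast
    then show ?thesis using edge_iff by blast
  qed
  then have "G = double_star u v A B"
    using verts' by (metis prod_eqI subset_antisym subsetI)
  then show ?thesis using data by blast
qed

lemma double_stars_isomorphic:
  assumes "double_star_data m n u v A B" "double_star_data m n u' v' A' B'"
  shows "isomorphic (double_star u v A B) (double_star u' v' A' B')"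
proof -
  obtain g h where g: "bij_betw g A A'" and h: "bij_betw h B B'"
    using assms unfolding double_star_data_def by (metis finite_same_card_bij)
  define f where
    "f x = (if x = u then u' else if x = v then v' else if x \<in> A then g x else h x)" for x
  note data = assms[unfolded double_star_data_def]
  have f: "f u = u'" "f v = v'" "\<And>x. x \<in> A \<Longrightarrow> f x = g x" "\<And>x. x \<in> B \<Longrightarrow> f x = h x"
    using data by (auto simp: f_def)
  have fA: "f ` A = A'" and fB: "f ` B = B'"
    using g h f by (auto simp: bij_betw_def)
  \<comment> \<open>The image is the whole second vertex set, which has the same size.\<close>
  have inj: "inj_on f ({u, v} \<union> A \<union> B)"
  proof (rule eq_card_imp_inj_on)
    have im: "f ` ({u, v} \<union> A \<union> B) = {u', v'} \<union> A' \<union> B'"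
      using f(1,2) fA fB by (simp add: image_Un)
    have "card ({u, v} \<union> A \<union> B) = 2 + m + n" "card ({u', v'} \<union> A' \<union> B') = 2 + m + n"
      using data by (subst card_Un_disjoint; auto simp: card_Un_disjoint)+
    then show "card (f ` ({u, v} \<union> A \<union> B)) = card ({u, v} \<union> A \<union> B)" using im by simp
  qed (use data in auto)
  have mem: "f x = f y \<longleftrightarrow> x = y" "f x \<in> f ` A \<longleftrightarrow> x \<in> A" "f x \<in> f ` B \<longleftrightarrow> x \<in> B"
    if "x \<in> {u, v} \<union> A \<union> B" "y \<in> {u, v} \<union> A \<union> B" for x y
    using that inj inj_on_image_mem_iff[OF inj that(1)] by (auto simp: inj_on_eq_iff)
  show ?thesis
    unfolding isomorphic_def
  proof (intro exI[of _ f] conjI ballI)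
    show "bij_betw f (verts (double_star u v A B)) (verts (double_star u' v' A' B'))"
      using inj f(1,2) fA fB by (simp add: double_star_def bij_betw_def image_Un)
  next
    fix x y assume "x \<in> verts (double_star u v A B)" "y \<in> verts (double_star u v A B)"
    then have xy: "x \<in> {u, v} \<union> A \<union> B" "y \<in> {u, v} \<union> A \<union> B" by (auto simp: double_star_def)
    have c: "u \<in> {u, v} \<union> A \<union> B" "v \<in> {u, v} \<union> A \<union> B" by auto
    show "{x, y} \<in> edges (double_star u v A B) \<longleftrightarrow> {f x, f y} \<in> edges (double_star u' v' A' B')"
      unfolding edge_double_star_iff fA[symmetric] fB[symmetric] f(1,2)[symmetric]
      using mem[OF xy(1) c(1)] mem[OF xy(1) c(2)] mem[OF xy(2) c(1)] mem[OF xy(2) c(2)] by simp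
  qed
qed

lemma isomorphic_to_double_starD:
  assumes "isomorphic H (double_star u v A B)" "double_star_data m n u v A B"
  shows "\<exists>u' v' A' B'. double_star_data m n u' v' A' B' \<and> verts H = {u', v'} \<union> A' \<union> B' \<and>
    edges (double_star u' v' A' B') \<subseteq> edges H"
proof -
  let ?D = "double_star u v A B"
  obtain f where f: "bij_betw f (verts H) (verts ?D)"
    and pres: "\<And>x y. x \<in> verts H \<Longrightarrow> y \<in> verts H \<Longrightarrow> {x, y} \<in> edges H \<longleftrightarrow> {f x, f y} \<in> edges ?D"
    using assms(1) unfolding isomorphic_def by blast
  define g where "g = inv_into (verts H) f"
  have g: "bij_betw g (verts ?D) (verts H)" unfolding g_def by (rule bij_betw_inv_into[OF f])
  have edge: "{g x, g y} \<in> edges H"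
    if "x \<in> verts ?D" "y \<in> verts ?D" "{x, y} \<in> edges ?D" for x y
    using that pres[of "g x" "g y"] bij_betwE[OF g] bij_betw_inv_into_right[OF f]
    unfolding g_def by simp
  have vD: "verts ?D = {u, v} \<union> A \<union> B" by (simp add: double_star_def)
  note data = assms(2)[unfolded double_star_data_def]
  have inj: "inj_on g ({u, v} \<union> A \<union> B)" and im: "g ` ({u, v} \<union> A \<union> B) = verts H"
    using g unfolding vD bij_betw_def by auto
  have "double_star_data m n (g u) (g v) (g ` A) (g ` B)"
    unfolding double_star_data_def
  proof (intro conjI)
    show "card (g ` A) = m" "card (g ` B) = n"
      using data card_image[OF inj_on_subset[OF inj]] by auto
    show "g u \<noteq> g v" using inj data by (auto simp: inj_on_eq_iff)
    show "g u \<notin> g ` A \<union> g ` B" "g v \<notin> g ` A \<union> g ` B" 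
      using data inj_on_image_mem_iff[OF inj, of _ "A \<union> B"] by (auto simp flip: image_Un)
    have "g ` A \<inter> g ` B = g ` (A \<inter> B)"
      by (rule inj_on_image_Int[OF inj, symmetric]) auto
    then show "g ` A \<inter> g ` B = {}" using data by simp
  qed (use data in auto)
  moreover have "verts H = {g u, g v} \<union> g ` A \<union> g ` B"
    using im by auto
  moreover have "edges (double_star (g u) (g v) (g ` A) (g ` B)) \<subseteq> edges H"
  proof
    fix e assume "e \<in> edges (double_star (g u) (g v) (g ` A) (g ` B))"
    then consider "e = {g u, g v}" | x where "x \<in> A" "e = {g u, g x}" | x where "x \<in> B" "e = {g v, g x}"
      unfolding double_star_def by auto
    then show "e \<in> edges H"
      by cases (auto intro!: edge simp: vD edge_double_star_iff)
  qed
  ultimately show ?thesis by blast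
qed

definition monochromatic_bistar ::
  "nat \<Rightarrow> nat \<Rightarrow> 'a set \<Rightarrow> ('a set \<Rightarrow> bool) \<Rightarrow> bool" where
  "monochromatic_bistar m n V c \<longleftrightarrow> (\<exists>k u v A B. double_star_data m n u v A B \<and>
     {u, v} \<union> A \<union> B \<subseteq> V \<and> (\<forall>e\<in>edges (double_star u v A B). c e = k))"

lemma ramsey_property_bistar_iff:
  assumes "bistar m n G" "m \<ge> 1" "n \<ge> 1"
  shows "ramsey_property G r \<longleftrightarrow> (\<forall>c. monochromatic_bistar m n {..<r} c)"
proof -
  obtain u v A B where data: "double_star_data m n u v A B" and G: "G = double_star u v A B"
    using bistar_is_double_star[OF assms] by blast
  have "(\<exists>H. subgraph H (complete_graph r) \<and> (\<exists>color. \<forall>e\<in>edges H. c e = color) \<and> isomorphic H G)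
      \<longleftrightarrow> monochromatic_bistar m n {..<r} c" for c :: "nat set \<Rightarrow> bool"
  proof
    assume "\<exists>H. subgraph H (complete_graph r) \<and> (\<exists>color. \<forall>e\<in>edges H. c e = color) \<and> isomorphic H G"
    then obtain H k where H: "verts H \<subseteq> {..<r}" "\<forall>e\<in>edges H. c e = k" "isomorphic H G"
      unfolding subgraph_def complete_graph_def by auto
    obtain u' v' A' B' where d: "double_star_data m n u' v' A' B'"
      and vH: "verts H = {u', v'} \<union> A' \<union> B'" and eH: "edges (double_star u' v' A' B') \<subseteq> edges H"
      using isomorphic_to_double_starD[OF H(3)[unfolded G] data] by blast
    have "{u', v'} \<union> A' \<union> B' \<subseteq> {..<r}" using H(1) vH by simp
    moreover have "\<forall>e\<in>edges (double_star u' v' A' B'). c e = k" using H(2) eH by blast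
    ultimately show "monochromatic_bistar m n {..<r} c"
      using d unfolding monochromatic_bistar_def by metis
  next
    assume "monochromatic_bistar m n {..<r} c"
    then obtain k u' v' A' B' where d: "double_star_data m n u' v' A' B'"
      and sub: "{u', v'} \<union> A' \<union> B' \<subseteq> {..<r}" and k: "\<forall>e\<in>edges (double_star u' v' A' B'). c e = k"
      unfolding monochromatic_bistar_def by (elim exE conjE) (rule that; assumption)
    let ?H = "double_star u' v' A' B'"
    have "simple_graph ?H" by (rule simple_graph_double_star[OF d])
    moreover have "verts ?H \<subseteq> {..<r}" using sub by (simp add: double_star_def)
    ultimately have "subgraph ?H (complete_graph r)"
      using nsets_mono[of "verts ?H" "{..<r}" 2]
      unfolding subgraph_def complete_graph_def simple_graph_def by auto
    then show "\<exists>H. subgraph H (complete_graph r) \<and> (\<exists>color. \<forall>e\<in>edges H. c e = color) \<and> isomorphic H G"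
      using k double_stars_isomorphic[OF d data] unfolding G by (intro exI[of _ ?H] conjI exI[of _ k])
  qed
  then show ?thesis unfolding ramsey_property_def by blast
qed

section \<open>The lower bound\<close>

text \<open>The edges with \<^term>\<open>e \<subseteq> X \<or> e \<inter> X = {}\<close> form the color \<^term>\<open>True\<close>. A connected graph in
  this color stays on one side of \<open>X\<close>, and in the other color the sides of a bistar are its
  bipartition classes \<open>{v} \<union> A\<close> and \<open>{u} \<union> B\<close>.\<close>

lemma coloring_without_bistar:
  assumes "finite V" "X \<subseteq> V" "card X \<le> m + n + 1" "card (V - X) \<le> m" "m \<le> n"
  shows "\<not> monochromatic_bistar m n V (\<lambda>e. e \<subseteq> X \<or> e \<inter> X = {})"
proof
  assume "monochromatic_bistar m n V (\<lambda>e. e \<subseteq> X \<or> e \<inter> X = {})"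
  then obtain k u v A B where data: "double_star_data m n u v A B" and sub: "{u, v} \<union> A \<union> B \<subseteq> V"
    and k: "\<forall>e\<in>edges (double_star u v A B). (e \<subseteq> X \<or> e \<inter> X = {}) = k"
    unfolding monochromatic_bistar_def by (elim exE conjE) (rule that; assumption)
  have edge: "(x \<in> X \<longleftrightarrow> y \<in> X) \<longleftrightarrow> k" if "{x, y} \<in> edges (double_star u v A B)" for x y
    using k that by auto
  have uv: "(u \<in> X \<longleftrightarrow> v \<in> X) \<longleftrightarrow> k" and A: "\<And>x. x \<in> A \<Longrightarrow> (u \<in> X \<longleftrightarrow> x \<in> X) \<longleftrightarrow> k"
    and B: "\<And>x. x \<in> B \<Longrightarrow> (v \<in> X \<longleftrightarrow> x \<in> X) \<longleftrightarrow> k"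
    by (auto intro!: edge simp: edge_double_star_iff)
  have fin: "finite X" "finite (V - X)" using assms by (auto intro: finite_subset)
  have cards: "card (insert v A) = m + 1" "card (insert u B) = n + 1"
      "card ({u, v} \<union> A \<union> B) = m + n + 2"
    using data unfolding double_star_data_def by (auto simp: card_Un_disjoint)
  show False
  proof (cases k)
    case True
    then have "{u, v} \<union> A \<union> B \<subseteq> X \<or> {u, v} \<union> A \<union> B \<subseteq> V - X"
      using uv A B sub by blast
    then have "m + n + 2 \<le> card X \<or> m + n + 2 \<le> card (V - X)"
      unfolding cards(3)[symmetric] using card_mono[OF fin(1)] card_mono[OF fin(2)] by blast
    then show False using assms by linarith
  next
    case False
    then have "insert v A \<subseteq> V - X \<or> insert u B \<subseteq> V - X"
      using uv A B sub by blast
    then have "m + 1 \<le> card (V - X) \<or> n + 1 \<le> card (V - X)"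
      unfolding cards(1,2)[symmetric] using card_mono[OF fin(2)] by blast
    then show False using assms by linarith
  qed
qed

section \<open>The upper bound\<close>

definition color_nbrs :: "'a set \<Rightarrow> ('a set \<Rightarrow> bool) \<Rightarrow> bool \<Rightarrow> 'a \<Rightarrow> 'a set" where
  "color_nbrs V c k u = {w \<in> V. w \<noteq> u \<and> c {u, w} = k}"

lemma color_nbrs_sym:
  "u \<in> V \<Longrightarrow> w \<in> color_nbrs V c k u \<Longrightarrow> u \<in> color_nbrs V c k w"
  by (auto simp: color_nbrs_def insert_commute)

lemma finite_color_nbrs [simp]: "finite V \<Longrightarrow> finite (color_nbrs V c k u)"
  by (simp add: color_nbrs_def)

lemma color_degrees_sum:
  assumes "finite V" "u \<in> V"
  shows "card (color_nbrs V c k u) + card (color_nbrs V c (\<not> k) u) = card V - 1"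
proof -
  have "color_nbrs V c k u \<union> color_nbrs V c (\<not> k) u = V - {u}"
    "color_nbrs V c k u \<inter> color_nbrs V c (\<not> k) u = {}"
    by (auto simp: color_nbrs_def)
  then show ?thesis
    using assms card_Un_disjoint[of "color_nbrs V c k u" "color_nbrs V c (\<not> k) u"]
    by (simp add: card_Diff_singleton)
qed

text \<open>Hall's condition for a system of two disjoint sets of prescribed sizes. The set \<open>A\<close> takes
  elements outside \<open>Y\<close> for as long as there are any.\<close>

lemma disjoint_subsets_of_cards:
  assumes "finite X" "finite Y" "m \<le> card X" "n \<le> card Y" "m + n \<le> card (X \<union> Y)"
  shows "\<exists>A B. A \<subseteq> X \<and> B \<subseteq> Y \<and> A \<inter> B = {} \<and> card A = m \<and> card B = n"
proof (cases "m \<le> card (X - Y)")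
  case True
  then obtain A where "A \<subseteq> X - Y" "card A = m" by (meson obtain_subset_with_card_n)
  moreover obtain B where "B \<subseteq> Y" "card B = n" using assms by (meson obtain_subset_with_card_n)
  ultimately show ?thesis by (intro exI[of _ A] exI[of _ B]) auto
next
  case False
  then obtain A where A: "X - Y \<subseteq> A" "A \<subseteq> X" "card A = m"
    using exists_subset_between[of "X - Y" m X] assms by auto
  have "Y - A = (X \<union> Y) - A" using A by blast
  then have "card (Y - A) = card (X \<union> Y) - m"
    using A assms by (metis card_Diff_subset finite_subset le_supI1)
  then have "n \<le> card (Y - A)" using assms(5) by linarith
  then obtain B where "B \<subseteq> Y - A" "card B = n" by (meson obtain_subset_with_card_n)
  then show ?thesis using A by (intro exI[of _ A] exI[of _ B]) auto
qed

text \<open>Deleting the two centers from the union of the neighborhoods leaves \<open>m + n\<close> candidates for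
  leaves.\<close>

lemma monochromatic_bistarI:
  assumes V: "finite V" and u: "u \<in> V" and v: "v \<in> color_nbrs V c k u"
    and du: "m + 1 \<le> card (color_nbrs V c k u)" and dv: "n + 1 \<le> card (color_nbrs V c k v)"
    and un: "m + n + 2 \<le> card (color_nbrs V c k u \<union> color_nbrs V c k v)"
  shows "monochromatic_bistar m n V c"
proof -
  define X where "X = color_nbrs V c k u - {v}"
  define Y where "Y = color_nbrs V c k v - {u}"
  have u': "u \<in> color_nbrs V c k v" using color_nbrs_sym[OF u v] .
  have X: "finite X" "m \<le> card X" and Y: "finite Y" "n \<le> card Y"
    using V du dv u' v by (auto simp: X_def Y_def card_Diff_singleton)
  have irr: "u \<notin> color_nbrs V c k u" "v \<notin> color_nbrs V c k v" by (auto simp: color_nbrs_def)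
  have "X \<union> Y = color_nbrs V c k u \<union> color_nbrs V c k v - {u, v}"
    using irr by (auto simp: X_def Y_def)
  moreover have "card {u, v} \<le> 2" by (simp add: card_insert_if)
  ultimately have "m + n \<le> card (X \<union> Y)"
    using un diff_card_le_card_Diff[of "{u, v}" "color_nbrs V c k u \<union> color_nbrs V c k v"] by simp
  then obtain A B where AB: "A \<subseteq> X" "B \<subseteq> Y" "A \<inter> B = {}" "card A = m" "card B = n"
    using disjoint_subsets_of_cards[OF X(1) Y(1) X(2) Y(2)] by blast
  have "finite A" "finite B" using AB X(1) Y(1) by (auto intro: finite_subset)
  moreover have "u \<noteq> v" using v by (auto simp: color_nbrs_def)
  ultimately have "double_star_data m n u v A B"
    using AB irr unfolding double_star_data_def X_def Y_def by auto
  moreover have "{u, v} \<union> A \<union> B \<subseteq> V"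
    using u v AB(1,2) by (auto simp: X_def Y_def color_nbrs_def)
  moreover have "\<forall>e\<in>edges (double_star u v A B). c e = k"
    using v AB(1,2) by (auto simp: double_star_def X_def Y_def color_nbrs_def)
  ultimately show ?thesis unfolding monochromatic_bistar_def by metis
qed

text \<open>A vertex with at least \<open>m + n + 1\<close> red neighbors would force each of them to have red degree at
  most \<open>m\<close>, hence blue degree at least \<open>m + n + 1\<close>. Then no two of them are joined in blue, as this
  edge would carry a blue bistar; so they form a red clique, and their red degrees are large.\<close>

lemma color_degree_le:
  assumes V: "finite V" and N: "card V = 2 * m + n + 2"
    and no: "\<not> monochromatic_bistar m n V c" and v: "v \<in> V"
  shows "card (color_nbrs V c k v) \<le> m + n"
proof (rule ccontr)
  let ?S = "color_nbrs V c k v"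
  assume "\<not> card ?S \<le> m + n"
  then have large: "m + n + 1 \<le> card ?S" by simp
  \<comment> \<open>An end of an edge is a neighbor of the other end, which gives the last of the \<open>m + n + 2\<close> vertices.\<close>
  have cover: "m + n + 2 \<le> card (color_nbrs V c j x \<union> color_nbrs V c j y)"
    if "m + n + 1 \<le> card (color_nbrs V c j y)" "y \<in> color_nbrs V c j x" for j x y
  proof -
    have "y \<notin> color_nbrs V c j y" by (auto simp: color_nbrs_def)
    then have "m + n + 2 \<le> card (insert y (color_nbrs V c j y))" using V that by simp
    also have "\<dots> \<le> card (color_nbrs V c j x \<union> color_nbrs V c j y)"
      using V that by (intro card_mono) auto
    finally show ?thesis .
  qed
  have small: "card (color_nbrs V c k x) \<le> m" if "x \<in> ?S" for x
  proof (rule ccontr)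
    assume "\<not> card (color_nbrs V c k x) \<le> m"
    moreover have "x \<in> V" using that by (simp add: color_nbrs_def)
    moreover have "v \<in> color_nbrs V c k x" using color_nbrs_sym[OF v that] .
    ultimately show False
      using monochromatic_bistarI[OF V, of x v c k m n] cover[OF large] large no by simp
  qed
  have other: "m + n + 1 \<le> card (color_nbrs V c (\<not> k) x)" if "x \<in> ?S" for x
  proof -
    have "x \<in> V" using that by (simp add: color_nbrs_def)
    then show ?thesis using color_degrees_sum[OF V, of x c k] small[OF that] N by simp
  qed
  have clique: "c {x, y} = k" if "x \<in> ?S" "y \<in> ?S" "x \<noteq> y" for x y
  proof (rule ccontr)
    assume "c {x, y} \<noteq> k"
    then have y: "y \<in> color_nbrs V c (\<not> k) x" and x: "x \<in> V"
      using that by (auto simp: color_nbrs_def)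
    then show False
      using monochromatic_bistarI[OF V x y, of m n] cover[OF other[OF that(2)] y]
        other[OF that(1)] other[OF that(2)] no by simp
  qed
  obtain x where x: "x \<in> ?S" using large by fastforce
  have "insert v (?S - {x}) \<subseteq> color_nbrs V c k x"
    using color_nbrs_sym[OF v x] clique[OF x] by (auto simp: color_nbrs_def)
  from order_trans[OF card_mono[OF finite_color_nbrs[OF V] this] small[OF x]]
  have "card (insert v (?S - {x})) \<le> m" .
  moreover have "card (insert v (?S - {x})) = card ?S"
    using V x large by (simp add: card_insert_if card_Diff_singleton color_nbrs_def)
  ultimately show False using large by simp
qed

text \<open>The vertices outside both neighborhoods are those joined to \<open>w\<close> and \<open>q\<close> by the other color. The
  degrees decide which end of the edge can serve as the center with \<open>n\<close> leaves.\<close>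

lemma common_other_color_nbrs:
  assumes V: "finite V" and N: "card V = 2 * m + n + 2" and mn: "m \<le> n" "n \<le> m + 1"
    and no: "\<not> monochromatic_bistar m n V c" and w: "w \<in> V" and q: "q \<in> color_nbrs V c k w"
  shows "m + 1 \<le> card {x \<in> color_nbrs V c (\<not> k) w. c {x, q} \<noteq> k}"
proof -
  let ?W = "color_nbrs V c k w" and ?Q = "color_nbrs V c k q"
  have qV: "q \<in> V" using q by (simp add: color_nbrs_def)
  have wq: "w \<in> ?Q" using color_nbrs_sym[OF w q] .
  \<comment> \<open>The degree in the other color is at most \<open>m + n\<close>, out of \<open>2m + n + 1\<close>.\<close>
  have "m + 1 \<le> card (color_nbrs V c k x)" if "x \<in> V" for x
    using color_degrees_sum[OF V that, of c k] color_degree_le[OF V N no that, of "\<not> k"] N by simp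
  then have low: "m + 1 \<le> card ?W" "m + 1 \<le> card ?Q" using w qV by auto
  have "card (?W \<union> ?Q) \<le> m + n + 1"
  proof -
    consider "n + 1 \<le> card ?Q" | "n + 1 \<le> card ?W" | "card ?W \<le> n" "card ?Q \<le> n" by linarith
    then show ?thesis
    proof cases
      case 1
      then show ?thesis using monochromatic_bistarI[OF V w q low(1), of n] no by linarith
    next
      case 2
      then show ?thesis
        using monochromatic_bistarI[OF V qV wq low(2), of n] no unfolding Un_commute[of ?W] by linarith
    next
      case 3
      then show ?thesis using card_Un_le[of ?W ?Q] mn by linarith
    qed
  qed
  moreover have "{x \<in> color_nbrs V c (\<not> k) w. c {x, q} \<noteq> k} = V - (?W \<union> ?Q)"
    using q wq qV by (auto simp: color_nbrs_def insert_commute)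
  moreover have "card (V - (?W \<union> ?Q)) = card V - card (?W \<union> ?Q)"
    using V by (intro card_Diff_subset) (auto simp: color_nbrs_def)
  ultimately show ?thesis using N by simp
qed

text \<open>The two sums count the pairs in \<open>R \<times> S\<close> for which \<open>P\<close> fails and those for which it holds.\<close>

lemma sum_card_relation_complement:
  assumes "finite R" "finite S"
  shows "(\<Sum>a\<in>R. card {b \<in> S. \<not> P a b}) + (\<Sum>b\<in>S. card {a \<in> R. P a b}) = card R * card S"
proof -
  have "(\<Sum>b\<in>S. card {a \<in> R. P a b}) = (\<Sum>b\<in>S. \<Sum>a\<in>R. if P a b then 1 else 0)"
    using assms by (simp add: sum.If_cases Int_def)
  also have "\<dots> = (\<Sum>a\<in>R. \<Sum>b\<in>S. if P a b then 1 else 0)" by (rule sum.swap)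
  also have "\<dots> = (\<Sum>a\<in>R. card {b \<in> S. P a b})"
    using assms by (simp add: sum.If_cases Int_def)
  finally have "(\<Sum>a\<in>R. card {b \<in> S. \<not> P a b}) + (\<Sum>b\<in>S. card {a \<in> R. P a b}) =
      (\<Sum>a\<in>R. card {b \<in> S. \<not> P a b} + card {b \<in> S. P a b})"
    by (simp add: sum.distrib)
  also have "\<dots> = (\<Sum>a\<in>R. card S)"
  proof (rule sum.cong[OF refl])
    fix a
    have "{b \<in> S. \<not> P a b} \<union> {b \<in> S. P a b} = S" by blast
    then show "card {b \<in> S. \<not> P a b} + card {b \<in> S. P a b} = card S"
      using assms(2) card_Un_disjoint[of "{b \<in> S. \<not> P a b}" "{b \<in> S. P a b}"] by fastforce
  qed
  finally show ?thesis by simp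
qed

text \<open>It suffices to count at a single vertex \<open>w\<close>: the sets bounded from below in
  \<open>common_other_color_nbrs\<close>, taken for all edges at \<open>w\<close>, partition the pairs of a red and a blue
  neighbor of \<open>w\<close>.\<close>

lemma monochromatic_bistar_exists:
  assumes V: "finite V" and N: "card V = 2 * m + n + 2" and mn: "m \<le> n" "n \<le> m + 1"
  shows "monochromatic_bistar m n V c"
proof (rule ccontr)
  assume no: "\<not> monochromatic_bistar m n V c"
  obtain w where w: "w \<in> V" using N by fastforce
  define R S where "R = color_nbrs V c True w" and "S = color_nbrs V c False w"
  have fin: "finite R" "finite S" using V by (simp_all add: R_def S_def)
  have RS: "card R + card S = 2 * m + n + 1"
    using color_degrees_sum[OF V w, of c True] N by (simp add: R_def S_def)
  have "card R * (m + 1) \<le> (\<Sum>a\<in>R. card {b \<in> S. \<not> c {a, b}})"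
  proof -
    have "m + 1 \<le> card {b \<in> S. \<not> c {a, b}}" if "a \<in> R" for a
      using common_other_color_nbrs[OF V N mn no w, of a True] that
      by (simp add: R_def S_def insert_commute)
    then show ?thesis using sum_bounded_below[of R "m + 1"] by simp
  qed
  moreover have "card S * (m + 1) \<le> (\<Sum>b\<in>S. card {a \<in> R. c {a, b}})"
  proof -
    have "m + 1 \<le> card {a \<in> R. c {a, b}}" if "b \<in> S" for b
      using common_other_color_nbrs[OF V N mn no w, of b False] that
      by (simp add: R_def S_def insert_commute)
    then show ?thesis using sum_bounded_below[of S "m + 1"] by simp
  qed
  ultimately have "(card R + card S) * (m + 1) \<le> card R * card S"
    using sum_card_relation_complement[OF fin, of "\<lambda>a b. c {a, b}"] by (simp add: algebra_simps)
  moreover have "4 * (card R * card S) \<le> (card R + card S) * (card R + card S)"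
  proof -
    have "0 \<le> (int (card R) - int (card S))\<^sup>2" by simp
    then have "int (4 * (card R * card S)) \<le> int ((card R + card S) * (card R + card S))"
      by (simp add: power2_eq_square algebra_simps)
    then show ?thesis by (simp only: of_nat_le_iff)
  qed
  ultimately have "4 * ((card R + card S) * (m + 1)) \<le> (card R + card S) * (card R + card S)"
    by linarith
  then have "(card R + card S) * (4 * (m + 1)) \<le> (card R + card S) * (card R + card S)"
    by (simp only: mult.left_commute)
  then have "4 * (m + 1) \<le> card R + card S" using RS by (simp only: mult_le_cancel1)
  then show False using RS mn by simp
qed

theorem theorem3p6:
  fixes m n :: nat and G :: "'a graph"
  assumes "m \<ge> 2" and "n \<in> {m, m + 1}" and "bistar m n G"
  shows "ramsey_number G = 2 * m + n + 2"
  unfolding ramsey_number_def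
proof (rule Least_equality)
  have mn: "m \<le> n" "n \<le> m + 1" "m \<ge> 1" "n \<ge> 1" using assms by auto
  note iff = ramsey_property_bistar_iff[OF assms(3) mn(3,4)]
  show "ramsey_property G (2 * m + n + 2)"
    unfolding iff using mn by (intro allI monochromatic_bistar_exists) auto
  fix r assume "ramsey_property G r"
  then have all: "\<And>c. monochromatic_bistar m n {..<r} c" unfolding iff by blast
  \<comment> \<open>Fewer than \<open>m + n + 1\<close> vertices all go into the first part of the extremal coloring.\<close>
  show "2 * m + n + 2 \<le> r"
  proof (rule ccontr)
    assume r: "\<not> 2 * m + n + 2 \<le> r"
    let ?X = "{..<min r (m + n + 1)}"
    have "card ({..<r} - ?X) = r - min r (m + n + 1)"
      by (subst card_Diff_subset) auto
    then have "card ({..<r} - ?X) \<le> m" using r by linarith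
    moreover have "finite {..<r}" "?X \<subseteq> {..<r}" "card ?X \<le> m + n + 1" by auto
    ultimately show False using all coloring_without_bistar mn(1) by blast
  qed
qed

end
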